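(* Let $\Omega\subseteq\mathbb{R}^n$ be open and let $u$ be an upper semicontinuous function on $\Omega$ with values in $[-\infty,\infty)$. Let $E_1\subseteq\Omega$ be the set of points $x\in\Omega$ at which $\nabla u(x)$ exists and $\nabla u(x)=0$. If $u$ is subharmonic on some open neighborhood of $\Omega\setminus E_1$ (that is, on some open set $\Omega'$ with $\Omega\setminus E_1\subseteq\Omega'\subseteq\Omega$), then $u$ is subharmonic on $\Omega$.
   Context: "$\nabla u(x)$ exists" means that $u(x)$ is finite and all first order partial derivatives of $u$ at $x$ exist as finite limits of difference quotients (no differentiability of $u$ at $x$, and no continuity of $u$, is required); $\nabla u(x)$ is the vector of these partial derivatives. *)

theory Defs
  imports "HOL-Analysis.Analysis"
begin

text \<open>
  Extended-real-valued functions are total functions into \<^typ>\<open>ereal\<close>; only their values on the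
  set under consideration matter.
\<close>

definition usc_on :: "'a::topological_space set \<Rightarrow> ('a \<Rightarrow> ereal) \<Rightarrow> bool" where
  "usc_on S u \<longleftrightarrow> (\<forall>c. openin (top_of_set S) {x \<in> S. u x < c})"

text \<open>
  The gradient exists at \<open>x\<close> and equals \<open>p\<close>: \<open>u x\<close> is finite and every difference quotient in a
  coordinate direction has a finite limit.  Neither differentiability nor continuity of \<open>u\<close> is
  implied.  The quotients are taken in \<^typ>\<open>ereal\<close>, so \<open>u\<close> may a priori be infinite near \<open>x\<close>.
\<close>

definition has_gradient :: "(real^'n \<Rightarrow> ereal) \<Rightarrow> real^'n \<Rightarrow> real^'n \<Rightarrow> bool" where
  "has_gradient u p x \<longleftrightarrow>
     \<bar>u x\<bar> \<noteq> \<infinity> \<and>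
     (\<forall>i. ((\<lambda>t. (u (x + t *\<^sub>R axis i 1) - u x) / ereal t) \<longlongrightarrow> ereal (p $ i)) (at 0))"

text \<open>
  For open \<open>S\<close>: \<open>h\<close> is twice continuously differentiable with vanishing Laplacian.  Here \<open>g\<close> is the
  gradient and \<open>H\<close> the Hessian matrix, so \<open>trace (H x)\<close> is the Laplacian of \<open>h\<close> at \<open>x\<close>.
\<close>

definition harmonic_on :: "(real^'n) set \<Rightarrow> (real^'n \<Rightarrow> real) \<Rightarrow> bool" where
  "harmonic_on S h \<longleftrightarrow>
     (\<exists>(g :: real^'n \<Rightarrow> real^'n) (H :: real^'n \<Rightarrow> real^'n^'n).
        (\<forall>x\<in>S. (h has_derivative (\<lambda>v. g x \<bullet> v)) (at x)) \<and>
        (\<forall>x\<in>S. (g has_derivative (\<lambda>v. H x *v v)) (at x)) \<and>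
        continuous_on S H \<and>
        (\<forall>x\<in>S. trace (H x) = 0))"

text \<open>
  Subharmonicity in the sense of Hoermander: upper semicontinuity with values in \<open>[-\<infinity>, \<infinity>)\<close> and
  domination by harmonic majorants on compact subsets.  As in that convention, \<open>u\<close> may be
  identically \<open>-\<infinity>\<close> on components of \<open>S\<close>.
\<close>

definition subharmonic_on :: "(real^'n) set \<Rightarrow> (real^'n \<Rightarrow> ereal) \<Rightarrow> bool" where
  "subharmonic_on S u \<longleftrightarrow>
     open S \<and> (\<forall>x\<in>S. u x < \<infinity>) \<and> usc_on S u \<and>
     (\<forall>K h. compact K \<and> K \<subseteq> S \<and> continuous_on K h \<and> harmonic_on (interior K) h \<and>
            (\<forall>x\<in>frontier K. u x \<le> ereal (h x))
        \<longrightarrow> (\<forall>x\<in>K. u x \<le> ereal (h x)))"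

end

theory Submission
  imports Defs
begin

text \<open>
  If \<open>u\<close> violates the maximum principle against a harmonic \<open>h\<close>, then subtracting a small multiple of
  \<open>|y - x\<^sub>1|\<^sup>2\<close> from \<open>h\<close> and Taylor expanding gives a quadratic polynomial \<open>q\<close> with negative Laplacian
  that touches \<open>u\<close> from above, strictly, at an interior point \<open>x\<close>.  For each small vector \<open>p\<close> the tilted
  polynomial \<open>q + p \<bullet> (y - x)\<close> touches \<open>u\<close>, up to a constant, at a point near \<open>x\<close>.  This point cannot
  lie in \<open>\<Omega>'\<close>, where \<open>u\<close> is subharmonic, so \<open>\<nabla>u = 0\<close> there and \<open>\<nabla>q + p\<close> vanishes.  If the Hessian of
  \<open>q\<close> is singular, a \<open>p\<close> outside its range is impossible.  If it is invertible, \<open>p\<close> can be chosen to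
  make the contact point any prescribed point near \<open>x\<close>, so \<open>\<nabla>u = 0\<close> throughout a neighbourhood of \<open>x\<close>;
  then \<open>u\<close> is constant there, \<open>q\<close> has a local minimum at \<open>x\<close>, and its Laplacian is nonnegative.
\<close>

section \<open>Maxima of upper semicontinuous functions\<close>

text \<open>Without a maximum, the sets \<open>w < c\<close> over real levels c below some value of
  w would cover K. The largest level of a finite subcover lies below some w y, yet y belongs to one
  of the covering sets.\<close>

lemma usc_attains_max:
  fixes w :: "'a::topological_space \<Rightarrow> ereal"
  assumes "compact K" "K \<noteq> {}"
    and usc: "\<And>c. openin (top_of_set K) {x \<in> K. w x < ereal c}"
  shows "\<exists>x\<in>K. \<forall>y\<in>K. w y \<le> w x"
proof (rule ccontr)
  assume neg: "\<not> ?thesis"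
  define T where "T = {c::real. \<exists>y\<in>K. ereal c < w y}"
  have "\<exists>U. open U \<and> {x \<in> K. w x < ereal c} = K \<inter> U" for c
    using usc[of c] unfolding openin_open by blast
  then obtain U where U: "\<And>c. open (U c)" "\<And>c. {x \<in> K. w x < ereal c} = K \<inter> U c"
    by metis
  have "K \<subseteq> (\<Union>c\<in>T. U c)"
  proof
    fix x assume x: "x \<in> K"
    then obtain y where y: "y \<in> K" "w x < w y"
      using neg by (auto simp: not_le)
    then obtain c where "w x < ereal c" "ereal c < w y"
      using ereal_dense2 by blast
    with x y U(2)[of c] show "x \<in> (\<Union>c\<in>T. U c)"
      unfolding T_def by blast
  qed
  then obtain C where C: "C \<subseteq> T" "finite C" "K \<subseteq> (\<Union>c\<in>C. U c)"
    using compactE_image[OF \<open>compact K\<close>, of T U] U(1) by metis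
  then have ne: "C \<noteq> {}" using \<open>K \<noteq> {}\<close> by auto
  then have "Max C \<in> T" using C(1,2) Max_in by blast
  then obtain y where y: "y \<in> K" "ereal (Max C) < w y" unfolding T_def by blast
  then obtain c where c: "c \<in> C" "y \<in> U c" using C by blast
  then have "w y < ereal c" using U(2)[of c] y by blast
  also have "\<dots> \<le> ereal (Max C)" using C c by simp
  finally show False using y by simp
qed

lemma usc_plus_continuous_attains_max:
  fixes u :: "'a::topological_space \<Rightarrow> ereal"
  assumes "usc_on S u" "K \<subseteq> S" "compact K" "K \<noteq> {}" "continuous_on K f"
  shows "\<exists>x\<in>K. \<forall>y\<in>K. u y + ereal (f y) \<le> u x + ereal (f x)"
proof (rule usc_attains_max[OF \<open>compact K\<close> \<open>K \<noteq> {}\<close>])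
  fix c :: real
  \<comment> \<open>A real d fits strictly between u x and c - f x, which separates the two
    summands.\<close>
  have "{x \<in> K. u x + ereal (f x) < ereal c} =
        (\<Union>d. {x \<in> K. u x < ereal d} \<inter> {x \<in> K. f x < c - d})" (is "?L = ?R")
  proof (intro equalityI subsetI)
    fix x assume x: "x \<in> ?L"
    then have "u x < ereal (c - f x)" by (cases "u x") auto
    then obtain d where "u x < ereal d" "ereal d < ereal (c - f x)"
      using ereal_dense2 by blast
    with x show "x \<in> ?R" by (intro UN_I[of d]) auto
  next
    fix x assume "x \<in> ?R"
    then obtain d where "x \<in> K" "u x < ereal d" "f x < c - d" by auto
    then show "x \<in> ?L" by (cases "u x") auto
  qed
  moreover have "openin (top_of_set K) {x \<in> K. u x < ereal d}" for d
  proof -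
    have "openin (top_of_set S) {x \<in> S. u x < ereal d}"
      using assms(1) unfolding usc_on_def by blast
    then obtain T where T: "open T" "{x \<in> S. u x < ereal d} = S \<inter> T"
      unfolding openin_open by blast
    then have "{x \<in> K. u x < ereal d} = K \<inter> T" using \<open>K \<subseteq> S\<close> by blast
    with T show ?thesis unfolding openin_open by blast
  qed
  moreover have "openin (top_of_set K) {x \<in> K. f x < c - d}" for d
  proof -
    have "openin (top_of_set K) (K \<inter> f -` {..<c - d})"
      using assms(5) by (intro continuous_openin_preimage_gen) auto
    then show ?thesis by (simp add: vimage_def Int_def)
  qed
  ultimately show "openin (top_of_set K) {x \<in> K. u x + ereal (f x) < ereal c}"
    by (auto intro!: openin_Union openin_Int)
qed

section \<open>Quadratic polynomials with symmetric matrix\<close>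

lemma inner_symmetric_matrix:
  fixes A :: "real^'n^'n"
  assumes "transpose A = A"
  shows "x \<bullet> (A *v y) = (A *v x) \<bullet> y"
  by (metis assms dot_lmul_matrix transpose_matrix_vector)

text \<open>Recentres the polynomial at v: the new linear coefficient is its gradient at v, the two
  cross terms being equal by symmetry.\<close>

lemma quadratic_expand:
  fixes A :: "real^'n^'n"
  assumes "transpose A = A"
  shows "b \<bullet> (v + w) + (v + w) \<bullet> (A *v (v + w)) =
    (b \<bullet> v + v \<bullet> (A *v v)) + ((b + 2 *\<^sub>R (A *v v)) \<bullet> w + w \<bullet> (A *v w))"
  using inner_symmetric_matrix[OF assms, of v w]
  by (simp add: matrix_vector_right_distrib inner_add inner_commute)

lemma inner_axis_matrix: "axis i 1 \<bullet> (A *v axis i (1::real)) = A $ i $ i"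
  by (simp add: inner_axis' matrix_vector_mul_component inner_axis)

lemma harmonic_on_quadratic:
  fixes A :: "real^'n^'n"
  assumes "transpose A = A" "trace A = 0"
  shows "harmonic_on S (\<lambda>x. c + b \<bullet> (x - y) + (x - y) \<bullet> (A *v (x - y)))"
  unfolding harmonic_on_def
proof (intro exI conjI ballI)
  fix x :: "real^'n"
  have lin: "((\<lambda>x. A *v (x - y)) has_derivative (\<lambda>v. A *v v)) (at x)"
    by (rule derivative_eq_intros bounded_linear.has_derivative[OF matrix_vector_mul_bounded_linear] | simp)+
  show "((\<lambda>x. c + b \<bullet> (x - y) + (x - y) \<bullet> (A *v (x - y))) has_derivative
     (\<lambda>v. (b + 2 *\<^sub>R (A *v (x - y))) \<bullet> v)) (at x)"
    apply (rule derivative_eq_intros lin refl)+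
    using inner_symmetric_matrix[OF assms(1), of "x - y"]
    by (auto simp: fun_eq_iff inner_add inner_commute)
  have "((\<lambda>x. b + 2 *\<^sub>R (A *v (x - y))) has_derivative (\<lambda>v. 2 *\<^sub>R (A *v v))) (at x)"
    by (rule derivative_eq_intros lin refl)+ simp
  then show "((\<lambda>x. b + 2 *\<^sub>R (A *v (x - y))) has_derivative (\<lambda>v. (2 *\<^sub>R A) *v v)) (at x)"
    by (simp add: scaleR_matrix_vector_assoc)
  show "trace (2 *\<^sub>R A) = 0" using assms(2) by (simp add: trace_def flip: sum_distrib_left)
qed (rule continuous_on_const)

text \<open>Adding a multiple of the identity shifts the Laplacian, keeps symmetry and changes the
  quadratic form only by a multiple of |v|^2.\<close>

lemma trace_plus_mat:
  fixes A :: "real^'n^'n"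
  shows "trace (A + c *\<^sub>R mat 1) = trace A + real CARD('n) * c"
  by (simp add: trace_def sum.distrib mat_def)

lemma transpose_plus_mat:
  fixes A :: "real^'n^'n"
  shows "transpose A = A \<Longrightarrow> transpose (A + c *\<^sub>R mat 1) = A + c *\<^sub>R mat 1"
  by (simp add: transpose_def mat_def vec_eq_iff)

lemma inner_plus_mat:
  fixes A :: "real^'n^'n"
  shows "v \<bullet> ((A + c *\<^sub>R mat 1) *v v) = v \<bullet> (A *v v) + c * (norm v)\<^sup>2"
  by (simp add: matrix_vector_mult_add_rdistrib inner_add
      flip: scaleR_matrix_vector_assoc power2_norm_eq_inner)

section \<open>Quadratic polynomials touching from above\<close>

text \<open>If the trace were negative, replacing k |v|^2 by its constant value on a small sphere
  would turn the polynomial into a harmonic function that has the same boundary values but lies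
  below u at the centre.\<close>

lemma subharmonic_on_touching_quadratic:
  fixes A :: "real^'n^'n"
  assumes sub: "subharmonic_on S u" and "y \<in> S" and A: "transpose A = A"
    and "u y = ereal a" and "e > 0"
    and le: "\<And>v. norm v < e \<Longrightarrow> u (y + v) \<le> ereal (a + b \<bullet> v + v \<bullet> (A *v v))"
  shows "trace A \<ge> 0"
proof (rule ccontr)
  assume neg: "\<not> ?thesis"
  \<comment> \<open>The mean of the diagonal; removing it from the diagonal leaves a trace-free
    matrix.\<close>
  define k where "k = trace A / real CARD('n)"
  define B where "B = A + (- k) *\<^sub>R mat 1"
  have k: "k < 0" using neg by (simp add: k_def divide_neg_pos)
  have B: "transpose B = B" "trace B = 0"
    unfolding B_def by (rule transpose_plus_mat[OF A], unfold trace_plus_mat) (simp add: k_def)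
  have "open S" using sub by (simp add: subharmonic_on_def)
  then obtain d where d: "d > 0" "cball y d \<subseteq> S"
    using \<open>y \<in> S\<close> open_contains_cball by blast
  define s where "s = min d (e / 2)"
  have s: "s > 0" "s \<le> d" "s < e" using d \<open>e > 0\<close> by (auto simp: s_def)
  define h where "h x = (a + k * s\<^sup>2) + b \<bullet> (x - y) + (x - y) \<bullet> (B *v (x - y))" for x
  have h: "harmonic_on T h" for T
    unfolding h_def by (rule harmonic_on_quadratic[OF B])
  have "continuous_on (cball y s) h"
    unfolding h_def
    by (intro continuous_intros linear_continuous_on_compose[OF _ matrix_vector_mul_linear])
  moreover have "u x \<le> ereal (h x)" if "x \<in> frontier (cball y s)" for x
  proof -
    have "norm (x - y) = s" using that by (simp add: dist_norm norm_minus_commute)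
    then have "h x = a + b \<bullet> (x - y) + (x - y) \<bullet> (A *v (x - y))"
      by (simp only: h_def B_def inner_plus_mat)
    then show ?thesis using le[of "x - y"] \<open>norm (x - y) = s\<close> s by simp
  qed
  moreover have "cball y s \<subseteq> S" using d s by auto
  ultimately have "\<forall>x\<in>cball y s. u x \<le> ereal (h x)"
    using sub h unfolding subharmonic_on_def by (metis compact_cball)
  then have "u y \<le> ereal (h y)" using s by simp
  then have "0 \<le> k * s\<^sup>2" using \<open>u y = ereal a\<close> by (simp add: h_def)
  moreover have "k * s\<^sup>2 < 0" using k s by (simp add: mult_neg_pos)
  ultimately show False by simp
qed

text \<open>Along each axis the upper bound makes the difference quotient of u at most that of the
  polynomial for t > 0 and at least that for t < 0; the one-sided limits then squeeze the partial
  derivative.\<close>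

lemma has_gradient_touching_quadratic:
  fixes A :: "real^'n^'n"
  assumes grad: "has_gradient u p y" and "u y = ereal a" and "e > 0"
    and le: "\<And>v. norm v < e \<Longrightarrow> u (y + v) \<le> ereal (a + b \<bullet> v + v \<bullet> (A *v v))"
  shows "b = p"
proof -
  have "b $ i = p $ i" for i
  proof -
    define Q where "Q t = (u (y + t *\<^sub>R axis i 1) - u y) / ereal t" for t
    have lim: "(Q \<longlongrightarrow> ereal (p $ i)) (at 0)"
      using grad unfolding has_gradient_def Q_def by blast
    have qlim: "((\<lambda>t. ereal (b $ i + t * A $ i $ i)) \<longlongrightarrow> ereal (b $ i)) F"
      if "F \<le> at 0" for F
      using that by (intro tendsto_ereal) (auto intro!: tendsto_eq_intros intro: filterlim_mono)
    have ub: "u (y + t *\<^sub>R axis i 1) - u y \<le> ereal (t * (b $ i + t * A $ i $ i))"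
      if "\<bar>t\<bar> < e" for t
    proof -
      have "u (y + t *\<^sub>R axis i 1) \<le> ereal (a + t * (b $ i + t * A $ i $ i))"
        using le[of "t *\<^sub>R axis i 1"] that
        by (simp add: inner_axis inner_axis_matrix matrix_vector_mult_scaleR algebra_simps)
      then show ?thesis
        using \<open>u y = ereal a\<close> by (cases "u (y + t *\<^sub>R axis i 1)") auto
    qed
    have "p $ i \<le> b $ i"
    proof -
      have "\<forall>\<^sub>F t in at_right 0. Q t \<le> ereal (b $ i + t * A $ i $ i)"
      proof (rule eventually_at_rightI[of 0 e])
        fix t assume t: "t \<in> {0<..<e}"
        then show "Q t \<le> ereal (b $ i + t * A $ i $ i)"
          using ub[of t] unfolding Q_def
          by (intro ereal_divide_le_pos[THEN iffD2]) auto
      qed (rule \<open>e > 0\<close>)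
      then have "ereal (p $ i) \<le> ereal (b $ i)"
        using tendsto_le[OF _ qlim tendsto_mono[OF _ lim], of "at_right 0"] by (simp add: at_le)
      then show ?thesis by simp
    qed
    moreover have "b $ i \<le> p $ i"
    proof -
      have "\<forall>\<^sub>F t in at_left 0. ereal (b $ i + t * A $ i $ i) \<le> Q t"
      proof (rule eventually_at_leftI[of "-e" 0])
        fix t assume t: "t \<in> {-e<..<0}"
        \<comment> \<open>Dividing by negative t reverses the bound; a numerator -\<infinity> gives
          the quotient \<infinity>, which is harmless here.\<close>
        then show "ereal (b $ i + t * A $ i $ i) \<le> Q t"
          using ub[of t] unfolding Q_def
          by (cases "u (y + t *\<^sub>R axis i 1) - u y") (auto simp: field_simps)
      qed (use \<open>e > 0\<close> in simp)
      then have "ereal (b $ i) \<le> ereal (p $ i)"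
        using tendsto_le[OF _ tendsto_mono[OF _ lim] qlim, of "at_left 0"] by (simp add: at_le)
      then show ?thesis by simp
    qed
    ultimately show ?thesis by simp
  qed
  then show ?thesis by (simp add: vec_eq_iff)
qed

text \<open>On the segment u is finite with vanishing derivative, so it is constant. Segments along
  the axes suffice later to test the diagonal entries of a Hessian.\<close>

lemma zero_gradient_on_axis_constant:
  fixes u :: "real^'n \<Rightarrow> ereal"
  assumes "\<And>z. norm z < r \<Longrightarrow> has_gradient u 0 (x + z)" and "\<bar>t\<bar> < r"
  shows "u (x + t *\<^sub>R axis i 1) = u x"
proof -
  define f where "f s = real_of_ereal (u (x + s *\<^sub>R axis i 1))" for s
  have fin: "u (x + s *\<^sub>R axis i 1) = ereal (f s)" if "\<bar>s\<bar> < r" for s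
    using assms(1)[of "s *\<^sub>R axis i 1"] that
    by (auto simp: has_gradient_def f_def ereal_real)
  have "(f has_real_derivative 0) (at s within {-r<..<r})" if s: "s \<in> {-r<..<r}" for s
  proof -
    have "((\<lambda>h. (u (x + s *\<^sub>R axis i 1 + h *\<^sub>R axis i 1) - u (x + s *\<^sub>R axis i 1)) / ereal h)
        \<longlongrightarrow> ereal 0) (at 0)"
      using assms(1)[of "s *\<^sub>R axis i 1"] s by (auto simp: has_gradient_def abs_less_iff)
    moreover have "\<forall>\<^sub>F h in at 0. (u (x + s *\<^sub>R axis i 1 + h *\<^sub>R axis i 1) - u (x + s *\<^sub>R axis i 1)) / ereal h
        = ereal ((f (s + h) - f s) / h)"
    proof (rule eventually_mono[OF eventually_at_ball'])
      \<comment> \<open>Within this radius s + h stays in the interval where u is finite, so the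
        extended quotient is a real one.\<close>
      show "0 < r - \<bar>s\<bar>" using s by auto
    next
      fix h :: real assume h: "h \<in> ball 0 (r - \<bar>s\<bar>) \<and> h \<noteq> 0 \<and> h \<in> UNIV"
      then have "\<bar>s + h\<bar> < r" "\<bar>s\<bar> < r" by auto
      then show "(u (x + s *\<^sub>R axis i 1 + h *\<^sub>R axis i 1) - u (x + s *\<^sub>R axis i 1)) / ereal h
        = ereal ((f (s + h) - f s) / h)"
        using fin[of "s + h"] fin[of s] h by (simp add: algebra_simps)
    qed
    ultimately have "((\<lambda>h. ereal ((f (s + h) - f s) / h)) \<longlongrightarrow> ereal 0) (at 0)"
      by (rule Lim_transform_eventually)
    then have "(f has_real_derivative 0) (at s)"
      unfolding DERIV_def by simp
    then show ?thesis by (rule has_field_derivative_at_within)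
  qed
  then obtain c where "\<And>s. s \<in> {-r<..<r} \<Longrightarrow> f s = c"
    using has_field_derivative_zero_constant[of "{-r<..<r}" f] by auto
  then have "f t = f 0" using assms(2) by (auto simp: abs_less_iff)
  then show ?thesis using fin[of t] fin[of 0] assms(2) by simp
qed

section \<open>Tilting the touching polynomial\<close>

text \<open>If the trace were negative, small linear tilts p would all produce contact points
  outside \<Omega>', with the equation b + p + 2 B v = 0. Whether B is singular or not, this family
  of contacts leads to a contradiction.\<close>

lemma touching_quadratic_trace_nonneg:
  fixes A :: "real^'n^'n"
  assumes usc: "usc_on \<Omega> u"
    and grad: "\<And>x. x \<in> \<Omega> - \<Omega>' \<Longrightarrow> has_gradient u 0 x"
    and sub: "subharmonic_on \<Omega>' u"
    and r: "r > 0" "cball x r \<subseteq> \<Omega>"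
    and A: "transpose A = A"
    and ux: "u x = ereal a"
    and le: "\<And>v. norm v \<le> r \<Longrightarrow> u (x + v) \<le> ereal (a + b \<bullet> v + v \<bullet> (A *v v))"
  shows "trace A \<ge> 0"
proof (rule ccontr)
  assume neg: "\<not> ?thesis"
  \<comment> \<open>With this value \<open>trace B\<close> is half of \<open>trace A\<close>, still
    negative, while the polynomial with B exceeds u by at least \<eta> |v|^2.\<close>
  define \<eta> where "\<eta> = - trace A / (2 * real CARD('n))"
  define B where "B = A + \<eta> *\<^sub>R mat 1"
  have \<eta>: "\<eta> > 0" using neg by (simp add: \<eta>_def divide_neg_pos)
  have B: "transpose B = B" unfolding B_def by (rule transpose_plus_mat[OF A])
  have tr: "trace B < 0" unfolding B_def trace_plus_mat using neg by (simp add: \<eta>_def)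
  have le': "u (x + v) \<le> ereal (a + b \<bullet> v + v \<bullet> (B *v v) - \<eta> * (norm v)\<^sup>2)"
    if "norm v \<le> r" for v
    using le[OF that] by (simp add: B_def inner_plus_mat add.assoc)
  have contact: "\<exists>v. norm v < r \<and> has_gradient u 0 (x + v) \<and> x + v \<notin> \<Omega>' \<and> b + p + 2 *\<^sub>R (B *v v) = 0"
    if p: "norm p < \<eta> * r" for p
  proof -
    \<comment> \<open>A maximum point of u + f is a contact point of the tilted polynomial, up to a
      constant.\<close>
    define f where "f y = - ((b + p) \<bullet> (y - x) + (y - x) \<bullet> (B *v (y - x)))" for y
    have "continuous_on (cball x r) f"
      unfolding f_def
      by (intro continuous_intros linear_continuous_on_compose[OF _ matrix_vector_mul_linear])
    then obtain y where y: "y \<in> cball x r"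
      and ymax: "\<And>z. z \<in> cball x r \<Longrightarrow> u z + ereal (f z) \<le> u y + ereal (f y)"
      using usc_plus_continuous_attains_max[OF usc r(2), of f] r by fastforce
    define v where "v = y - x"
    have v: "y = x + v" "norm v \<le> r"
      using y by (auto simp: v_def dist_norm norm_minus_commute)
    \<comment> \<open>Comparison with the centre, where f vanishes; it also excludes the value
      -\<infinity> at the contact point.\<close>
    have a_le: "ereal a \<le> u (x + v) + ereal (f (x + v))"
      using ymax[of x] ux r v by (simp add: f_def zero_ereal_def)
    have "u (x + v) \<noteq> \<infinity>" using le[OF v(2)] by auto
    moreover have "u (x + v) \<noteq> -\<infinity>" using a_le by auto
    ultimately obtain a' where a': "u (x + v) = ereal a'" by (cases "u (x + v)") auto
    \<comment> \<open>On the sphere the margin \<eta> r^2 beats the tilt, which is at most |p| r, so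
      the contact is interior.\<close>
    have "norm v \<noteq> r"
    proof
      assume nv: "norm v = r"
      have "a \<le> a' + f (x + v)" using a_le a' by simp
      moreover have "a' \<le> a + b \<bullet> v + v \<bullet> (B *v v) - \<eta> * r\<^sup>2"
        using le'[OF v(2)] a' nv by simp
      ultimately have "\<eta> * r\<^sup>2 \<le> - (p \<bullet> v)" by (simp add: f_def inner_add)
      also have "\<dots> \<le> norm p * r" using Cauchy_Schwarz_ineq2[of p v] nv by simp
      also have "\<dots> < \<eta> * r\<^sup>2" using p r by (simp add: power2_eq_square)
      finally show False by simp
    qed
    with v have nv: "norm v < r" by simp
    have touch: "u (x + v + w) \<le> ereal (a' + (b + p + 2 *\<^sub>R (B *v v)) \<bullet> w + w \<bullet> (B *v w))"
      if w: "norm w < r - norm v" for w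
    proof -
      have "norm (v + w) \<le> r" using w norm_triangle_ineq[of v w] by simp
      then have "x + (v + w) \<in> cball x r" by (metis add_diff_cancel_left' dist_commute dist_norm mem_cball)
      then have "u (x + (v + w)) + ereal (f (x + (v + w))) \<le> ereal (a' + f (x + v))"
        using ymax[of "x + (v + w)"] v a' by simp
      then have "u (x + (v + w)) \<le> ereal (a' + f (x + v) - f (x + (v + w)))"
        by (cases "u (x + (v + w))") auto
      then show ?thesis
        using quadratic_expand[OF B, of "b + p" v w] by (simp add: f_def add.assoc)
    qed
    have out: "x + v \<notin> \<Omega>'"
      using subharmonic_on_touching_quadratic[OF sub _ B a' _ touch, of "r - norm v"] nv tr by auto
    moreover have "x + v \<in> \<Omega>" using v y r by auto
    ultimately have "has_gradient u 0 (x + v)" using grad by blast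
    with out nv has_gradient_touching_quadratic[OF this a' _ touch, of "r - norm v"]
    show ?thesis by auto
  qed
  have "x \<in> \<Omega>" using r by auto
  \<comment> \<open>The untilted polynomial touches at x itself. Hence x is outside \<Omega>' and b
    = 0, and the contact equation becomes p + 2 B v = 0.\<close>
  have touch0: "u (x + v) \<le> ereal (a + b \<bullet> v + v \<bullet> (B *v v))" if "norm v < r" for v
  proof -
    have "\<eta> * (norm v)\<^sup>2 \<ge> 0" using \<eta> by simp
    then show ?thesis using le'[of v] that by (auto intro: order_trans)
  qed
  have "x \<notin> \<Omega>'"
    using subharmonic_on_touching_quadratic[OF sub _ B ux r(1) touch0] tr by auto
  then have "has_gradient u 0 x" using grad \<open>x \<in> \<Omega>\<close> by blast
  then have b: "b = 0" using has_gradient_touching_quadratic[OF _ ux r(1) touch0] by blast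
  have lin: "linear ((*v) B)" by simp
  show False
  proof (cases "surj ((*v) B)")
    case False
    then obtain q where q: "q \<notin> range ((*v) B)" by blast
    then have "q \<noteq> 0" by (metis matrix_vector_mult_0_right rangeI)
    \<comment> \<open>Rescaling q to norm \<eta> r / 2 makes the tilt admissible without bringing it
      into the range of B.\<close>
    define p where "p = (\<eta> * r / (2 * norm q)) *\<^sub>R q"
    have "norm p < \<eta> * r" using \<open>q \<noteq> 0\<close> \<eta> r by (simp add: p_def)
    then obtain v where "p + 2 *\<^sub>R (B *v v) = 0" using contact b by auto
    then have pv: "p = B *v ((-2) *\<^sub>R v)"
      unfolding matrix_vector_mult_scaleR by (simp add: eq_neg_iff_add_eq_0)
    have "q = (2 * norm q / (\<eta> * r)) *\<^sub>R p" using \<open>q \<noteq> 0\<close> \<eta> r by (simp add: p_def)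
    also have "\<dots> = B *v ((2 * norm q / (\<eta> * r)) *\<^sub>R ((-2) *\<^sub>R v))"
      unfolding pv by (simp only: matrix_vector_mult_scaleR)
    finally show False using q by blast
  next
    case True
    then have inj: "inj ((*v) B)" by (rule linear_surjective_imp_injective[OF lin _ refl])
    obtain M where M: "M > 0" "\<And>z. norm (B *v z) \<le> norm z * M"
      using bounded_linear.pos_bounded[OF matrix_vector_mul_bounded_linear[of B]] by blast
    \<comment> \<open>Chosen so that |z| < \<rho> makes -2 B z an admissible tilt. Its contact point
      v satisfies B v = B z, so injectivity gives v = z.\<close>
    define \<rho> where "\<rho> = \<eta> * r / (2 * M)"
    have \<rho>: "\<rho> > 0" using \<eta> r M by (simp add: \<rho>_def)
    have zero: "has_gradient u 0 (x + z)" if z: "norm z < \<rho>" for z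
    proof -
      have "norm ((-2) *\<^sub>R (B *v z)) \<le> 2 * (norm z * M)" using M(2)[of z] by simp
      also have "\<dots> < \<eta> * r" using z M by (simp add: \<rho>_def field_simps)
      finally obtain v where v: "has_gradient u 0 (x + v)" "(-2) *\<^sub>R (B *v z) + 2 *\<^sub>R (B *v v) = 0"
        using contact[of "(-2) *\<^sub>R (B *v z)"] b by auto
      then have "B *v v = B *v z" by simp
      then have "v = z" using inj by (simp add: inj_eq)
      with v show ?thesis by simp
    qed
    \<comment> \<open>As u equals a along the axes near x and b = 0, the touching inequality says
      that t^2 times the diagonal entry is nonnegative.\<close>
    have "B $ i $ i \<ge> 0" for i
    proof -
      define t where "t = min \<rho> r / 2"
      have t: "t > 0" "t < \<rho>" "t < r" using \<rho> r by (auto simp: t_def)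
      have "u (x + t *\<^sub>R axis i 1) = ereal a"
        using zero_gradient_on_axis_constant[OF zero, where t = t] t ux by simp
      then have "0 \<le> t * (t * B $ i $ i)"
        using touch0[of "t *\<^sub>R axis i 1"] t b
        by (simp add: inner_axis_matrix matrix_vector_mult_scaleR)
      then show ?thesis using t by (simp add: zero_le_mult_iff)
    qed
    then have "trace B \<ge> 0" by (simp add: trace_def sum_nonneg)
    with tr show False by simp
  qed
qed

section \<open>Taylor bound and symmetrized Hessian\<close>

text \<open>The first-order expansion of g at x is integrated along the segment from x to x + v, in
  the form of a monotonicity argument.\<close>

lemma second_order_upper_bound:
  fixes h :: "real^'n \<Rightarrow> real"
  assumes "open S" "x \<in> S"
    and dh: "\<And>y. y \<in> S \<Longrightarrow> (h has_derivative (\<lambda>v. g y \<bullet> v)) (at y)"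
    and dg: "(g has_derivative (\<lambda>v. H *v v)) (at x)"
    and "\<epsilon> > 0"
  shows "\<exists>r>0. \<forall>v. norm v \<le> r \<longrightarrow>
     h (x + v) \<le> h x + g x \<bullet> v + (v \<bullet> (H *v v)) / 2 + \<epsilon> * (norm v)\<^sup>2"
proof -
  obtain d where d: "d > 0"
    and gd: "\<And>y. norm (y - x) < d \<Longrightarrow> norm (g y - g x - H *v (y - x)) \<le> \<epsilon> * norm (y - x)"
    using dg \<open>\<epsilon> > 0\<close> unfolding has_derivative_at_alt by blast
  obtain s where s: "s > 0" "cball x s \<subseteq> S"
    using assms(1,2) open_contains_cball by blast
  define r where "r = min s (d / 2)"
  have r: "r > 0" "r \<le> s" "r < d" using d s by (auto simp: r_def)
  have "h (x + v) \<le> h x + g x \<bullet> v + (v \<bullet> (H *v v)) / 2 + \<epsilon> * (norm v)\<^sup>2" if v: "norm v \<le> r" for v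
  proof -
    \<comment> \<open>The derivative of f is the expansion error of g paired with v, minus t
      \<epsilon> |v|^2, hence nonpositive. At t = 1 this yields the error \<epsilon>/2, which is
      weakened to \<epsilon>.\<close>
    define f where "f t = h (x + t *\<^sub>R v) - t * (g x \<bullet> v) - t\<^sup>2 / 2 * (v \<bullet> (H *v v)) - t\<^sup>2 / 2 * \<epsilon> * (norm v)\<^sup>2" for t
    have "\<exists>D. (f has_real_derivative D) (at t) \<and> D \<le> 0" if t: "0 \<le> t" "t \<le> 1" for t
    proof (intro exI conjI)
      have tv: "norm (t *\<^sub>R v) \<le> r"
        using v t mult_left_le_one_le[of "norm v" t] by simp
      then have "x + t *\<^sub>R v \<in> S" using s r by (auto simp: dist_norm subset_iff)
      note dh' = dh[OF this]
      have "((\<lambda>t. h (x + t *\<^sub>R v)) has_derivative (\<lambda>k. g (x + t *\<^sub>R v) \<bullet> (k *\<^sub>R v))) (at t)"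
        by (rule has_derivative_compose[where f = "\<lambda>t. x + t *\<^sub>R v", OF _ dh'])
          (auto intro!: derivative_eq_intros)
      then have dline: "((\<lambda>t. h (x + t *\<^sub>R v)) has_real_derivative (g (x + t *\<^sub>R v) \<bullet> v)) (at t)"
        by (simp add: has_field_derivative_def mult.commute[of _ "g _ \<bullet> v"] fun_eq_iff)
      show "(f has_real_derivative
          (g (x + t *\<^sub>R v) \<bullet> v - g x \<bullet> v - t * (v \<bullet> (H *v v)) - t * \<epsilon> * (norm v)\<^sup>2)) (at t)"
        unfolding f_def by (rule derivative_eq_intros dline refl | simp)+
      have "(g (x + t *\<^sub>R v) - g x - H *v (t *\<^sub>R v)) \<bullet> v \<le>
          norm (g (x + t *\<^sub>R v) - g x - H *v (t *\<^sub>R v)) * norm v"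
        by (rule norm_cauchy_schwarz)
      also have "\<dots> \<le> (\<epsilon> * norm (t *\<^sub>R v)) * norm v"
        using gd[of "x + t *\<^sub>R v"] tv r by (intro mult_right_mono) auto
      also have "\<dots> = t * \<epsilon> * (norm v)\<^sup>2" using t by (simp add: power2_eq_square)
      finally show "g (x + t *\<^sub>R v) \<bullet> v - g x \<bullet> v - t * (v \<bullet> (H *v v)) - t * \<epsilon> * (norm v)\<^sup>2 \<le> 0"
        by (simp add: inner_diff matrix_vector_mult_scaleR inner_commute)
    qed
    then have "f 1 \<le> f 0" by (intro DERIV_nonpos_imp_nonincreasing[of 0 1 f]) auto
    moreover have "\<epsilon> * (norm v)\<^sup>2 \<ge> 0" using \<open>\<epsilon> > 0\<close> by simp
    ultimately show ?thesis by (simp add: f_def)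
  qed
  with r show ?thesis by blast
qed

text \<open>The predicate \<open>harmonic_on\<close> does not record symmetry of the Hessian, so its
  symmetric part is taken. The factor 1/4 combines this averaging with the 1/2 of the Taylor
  expansion.\<close>

lemma symmetrized_matrix:
  fixes H :: "real^'n^'n"
  defines "A \<equiv> (1/4) *\<^sub>R (H + transpose H)"
  shows "transpose A = A" "trace A = trace H / 2" "v \<bullet> (A *v v) = (v \<bullet> (H *v v)) / 2"
proof -
  show "transpose A = A" by (simp add: A_def transpose_def vec_eq_iff)
  have "trace A = (\<Sum>i\<in>UNIV. (1/2) * H $ i $ i)"
    by (simp add: A_def trace_def transpose_def)
  then show "trace A = trace H / 2" by (simp only: flip: sum_distrib_left) (simp add: trace_def)
  have "v \<bullet> (transpose H *v v) = v \<bullet> (H *v v)"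
    by (metis dot_lmul_matrix inner_commute transpose_matrix_vector)
  then show "v \<bullet> (A *v v) = (v \<bullet> (H *v v)) / 2"
    by (simp add: A_def matrix_vector_mult_add_rdistrib inner_add flip: scaleR_matrix_vector_assoc)
qed

section \<open>From a failing harmonic majorant to a touching quadratic\<close>

theorem theorem4p1:
  fixes \<Omega> \<Omega>' E\<^sub>1 :: "(real^'n) set" and u :: "real^'n \<Rightarrow> ereal"
  assumes "open \<Omega>"
    and "\<forall>x\<in>\<Omega>. u x < \<infinity>"
    and "usc_on \<Omega> u"
    and "E\<^sub>1 = {x \<in> \<Omega>. has_gradient u 0 x}"
    and "open \<Omega>'" and "\<Omega> - E\<^sub>1 \<subseteq> \<Omega>'" and "\<Omega>' \<subseteq> \<Omega>"
    and "subharmonic_on \<Omega>' u"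
  shows "subharmonic_on \<Omega> u"
  unfolding subharmonic_on_def
proof (intro conjI allI impI ballI)
  fix K h x1
  assume "compact K \<and> K \<subseteq> \<Omega> \<and> continuous_on K h \<and> harmonic_on (interior K) h \<and>
    (\<forall>x\<in>frontier K. u x \<le> ereal (h x))"
  then have K: "compact K" "K \<subseteq> \<Omega>" and ch: "continuous_on K h"
    and hh: "harmonic_on (interior K) h" and fr: "\<And>x. x \<in> frontier K \<Longrightarrow> u x \<le> ereal (h x)"
    by auto
  assume x1: "x1 \<in> K"
  show "u x1 \<le> ereal (h x1)"
  proof (rule ccontr)
    assume neg: "\<not> ?thesis"
    then obtain a1 where a1: "u x1 = ereal a1" "a1 > h x1"
      using assms(2) x1 K(2) by (cases "u x1") auto
    obtain D where D: "D > 0" "\<And>y. y \<in> K \<Longrightarrow> norm (y - x1) \<le> D"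
    proof -
      have "bounded ((\<lambda>y. y - x1) ` K)"
        using K(1) by (intro compact_imp_bounded compact_continuous_image continuous_intros)
      then show ?thesis using that unfolding bounded_pos by blast
    qed
    \<comment> \<open>The perturbation \<epsilon> |y - x1|^2 vanishes at x1 and is at most half of
      the violation a1 - h x1 on K. So u + f is smaller on the frontier than at x1, and its maximum
      is interior.\<close>
    define \<epsilon> where "\<epsilon> = (a1 - h x1) / (2 * D\<^sup>2)"
    have \<epsilon>: "\<epsilon> > 0" "\<epsilon> * D\<^sup>2 < a1 - h x1" using a1 D by (auto simp: \<epsilon>_def field_simps)
    define f where "f y = \<epsilon> * (norm (y - x1))\<^sup>2 - h y" for y
    have "continuous_on K f" unfolding f_def by (intro continuous_intros ch)
    then obtain x where x: "x \<in> K" and xmax: "\<And>y. y \<in> K \<Longrightarrow> u y + ereal (f y) \<le> u x + ereal (f x)"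
      using usc_plus_continuous_attains_max[OF assms(3) K(2,1), of f] x1 by blast
    have ge: "ereal (a1 - h x1) \<le> u x + ereal (f x)"
      using xmax[OF x1] a1 by (simp add: f_def)
    then obtain a where a: "u x = ereal a"
      using assms(2) x K(2) by (cases "u x") auto
    have "x \<notin> frontier K"
    proof
      assume "x \<in> frontier K"
      then have "a \<le> h x" using fr a by fastforce
      moreover have "\<epsilon> * (norm (x - x1))\<^sup>2 \<le> \<epsilon> * D\<^sup>2"
        using D(2)[OF x] \<epsilon> by (simp add: power_mono)
      ultimately show False using ge a \<epsilon>(2) by (simp add: f_def)
    qed
    then have xi: "x \<in> interior K" using x closure_subset by (fastforce simp: frontier_def)
    obtain g H where gH: "\<And>y. y \<in> interior K \<Longrightarrow> (h has_derivative (\<lambda>v. g y \<bullet> v)) (at y)"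
       "\<And>y. y \<in> interior K \<Longrightarrow> (g has_derivative (\<lambda>v. H y *v v)) (at y)"
       "\<And>y. y \<in> interior K \<Longrightarrow> trace (H y) = 0"
      using hh unfolding harmonic_on_def by blast
    obtain r0 where r0: "r0 > 0"
      and taylor: "\<And>v. norm v \<le> r0 \<Longrightarrow>
        h (x + v) \<le> h x + g x \<bullet> v + (v \<bullet> (H x *v v)) / 2 + \<epsilon> / 2 * (norm v)\<^sup>2"
      using second_order_upper_bound[OF open_interior xi gH(1) gH(2)[OF xi], of "\<epsilon> / 2"] \<epsilon>(1)
      by auto
    obtain s where s: "s > 0" "cball x s \<subseteq> interior K"
      using xi open_contains_cball open_interior by blast
    define r where "r = min r0 s"
    have r: "r > 0" "r \<le> r0" "cball x r \<subseteq> K"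
      using r0 s interior_subset[of K] by (auto simp: r_def subset_iff)
    define A0 where "A0 = (1/4) *\<^sub>R (H x + transpose (H x))"
    \<comment> \<open>The perturbation contributes -\<epsilon> |v|^2 and the Taylor error returns
      half of it. As \<open>A0\<close> is trace-free, a strictly negative trace remains.\<close>
    define A where "A = A0 + (- \<epsilon> / 2) *\<^sub>R mat 1"
    note A0 = symmetrized_matrix[where H = "H x", folded A0_def]
    have "trace A \<ge> 0"
    proof (rule touching_quadratic_trace_nonneg[OF assms(3) _ assms(8) r(1) _ _ a])
      show "transpose A = A" unfolding A_def by (rule transpose_plus_mat[OF A0(1)])
      show "has_gradient u 0 y" if "y \<in> \<Omega> - \<Omega>'" for y using that assms(4,6) by auto
      show "cball x r \<subseteq> \<Omega>" using r K by blast
      fix v :: "real^'n" assume v: "norm v \<le> r"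
      then have "x + v \<in> K" using r(3) by (auto simp: dist_norm subset_iff)
      from xmax[OF this] have "u (x + v) \<le> ereal (a + f x - f (x + v))"
        using a by (cases "u (x + v)") auto
      also have "a + f x - f (x + v) = a + h (x + v) - h x
          - \<epsilon> * ((norm (x - x1 + v))\<^sup>2 - (norm (x - x1))\<^sup>2)"
        by (simp add: f_def algebra_simps)
      \<comment> \<open>The cross term joins the linear coefficient; only |v|^2 affects the
        Hessian.\<close>
      also have "(norm (x - x1 + v))\<^sup>2 - (norm (x - x1))\<^sup>2 = 2 * ((x - x1) \<bullet> v) + (norm v)\<^sup>2"
        by (simp only: power2_norm_eq_inner) (simp add: inner_add inner_commute)
      also have "a + h (x + v) - h x - \<epsilon> * (2 * ((x - x1) \<bullet> v) + (norm v)\<^sup>2)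
          \<le> a + (g x - (2 * \<epsilon>) *\<^sub>R (x - x1)) \<bullet> v + v \<bullet> (A *v v)"
        using taylor[of v] v r(2)
        unfolding A_def inner_plus_mat A0(3) by (simp add: inner_diff_left algebra_simps)
      finally show "u (x + v) \<le> ereal (a + (g x - (2 * \<epsilon>) *\<^sub>R (x - x1)) \<bullet> v + v \<bullet> (A *v v))"
        by simp
    qed
    moreover have "trace A < 0"
      using \<epsilon>(1) gH(3)[OF xi] unfolding A_def trace_plus_mat by (simp add: A0(2))
    ultimately show False by simp
  qed
qed (use assms in auto)

end
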